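(* For every $n\ge 1$, the set of restricted involutions on $2n$ letters is in bijection with the set of skew-symmetric $(n,n)$-clans.
   Context: An $(n,n)$-clan is a string $\gamma=c_1\cdots c_{2n}$ of symbols from $\mathbb{N}\cup\{+,-\}$ such that each natural number appearing in $\gamma$ appears exactly twice, and the number of $+$'s equals the number of $-$'s; two clans are equal if they have the same $\pm$ symbols in the same positions and the same sets of positions of matching pairs of natural numbers. With $rev(\gamma)=c_{2n}\cdots c_1$ and $-\gamma$ obtained by interchanging $+$ and $-$, $\gamma$ is skew-symmetric if $\gamma=-rev(\gamma)$. A signed permutation of $m$ letters (an element of the hyperoctahedral group $\mathcal{C}_m$) is a word $\hat\pi=\hat\pi(1)\cdots\hat\pi(m)$ in which each of $1,\dots,m$ appears exactly once, possibly barred (a bar indicates a negative sign); $|\hat\pi|$ denotes the permutation obtained by removing all bars. A signed involution on $m$ letters is a signed permutation whose cycle representation consists of cycles (fixed points or $2$-cycles) whose symbols are either all unbarred or all barred; equivalently $|\hat\pi|$ is an involution and, for a $2$-cycle $(i,j)$ of $|\hat\pi|$, $\hat\pi(i)$ is barred iff $\hat\pi(j)$ is barred. The reverse is $\mathrm{Rev}(\hat\pi)=\hat\pi(m)\cdots\hat\pi(1)$; the complement $\mathrm{Comp}(\hat\pi)$ replaces each entry $a$ (barred or not) by $m+1-a$ with the same bar status. A signed permutation $\hat\pi$ avoids the pattern $\bar2\bar1$ if there are no indices $i<j$ with $\hat\pi(i)$ and $\hat\pi(j)$ both barred and $|\hat\pi(i)|>|\hat\pi(j)|$. A restricted involution on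 $2n$ letters is a signed involution $\hat\pi$ on $2n$ letters with $\hat\pi=\mathrm{Rev}(\mathrm{Comp}(\hat\pi))$ that avoids the pattern $\bar2\bar1$. *)

theory Defs
  imports Main
begin

datatype clan_symbol = Plus | Minus | Num nat

fun neg_symbol :: "clan_symbol \<Rightarrow> clan_symbol" where
  "neg_symbol Plus = Minus"
| "neg_symbol Minus = Plus"
| "neg_symbol (Num a) = Num a"

definition clan_strings :: "nat \<Rightarrow> clan_symbol list set" where
  "clan_strings n = {c. length c = 2 * n
     \<and> (\<forall>a. Num a \<in> set c \<longrightarrow> count_list c (Num a) = 2)
     \<and> count_list c Plus = count_list c Minus}"

definition symbol_positions :: "clan_symbol \<Rightarrow> clan_symbol list \<Rightarrow> nat set" where
  "symbol_positions s c = {i. i < length c \<and> c ! i = s}"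

definition matching_pairs :: "clan_symbol list \<Rightarrow> (nat \<times> nat) set" where
  "matching_pairs c = {(i, j). i < j \<and> j < length c \<and> (\<exists>a. c ! i = Num a \<and> c ! j = Num a)}"

text \<open>Two strings denote the same clan iff they are related by \<open>clan_rel\<close>; only the positions
  of the signs and of the mates matter, not the actual natural numbers used. Accordingly, a clan
  is an equivalence class of strings.\<close>

definition clan_rel :: "nat \<Rightarrow> (clan_symbol list \<times> clan_symbol list) set" where
  "clan_rel n = {(c, d). c \<in> clan_strings n \<and> d \<in> clan_strings n
     \<and> symbol_positions Plus c = symbol_positions Plus d
     \<and> symbol_positions Minus c = symbol_positions Minus d
     \<and> matching_pairs c = matching_pairs d}"

lemma equiv_clan_rel: "equiv (clan_strings n) (clan_rel n)"
  by (rule equivI) (auto simp: clan_rel_def refl_on_def sym_def trans_def)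

definition clans :: "nat \<Rightarrow> clan_symbol list set set" where
  "clans n = clan_strings n // clan_rel n"

text \<open>Reversal and negation are involutions on strings that respect the relation, so they act on
  clans by taking images of equivalence classes.\<close>

definition clan_rev :: "clan_symbol list set \<Rightarrow> clan_symbol list set" where
  "clan_rev \<gamma> = rev ` \<gamma>"

definition clan_neg :: "clan_symbol list set \<Rightarrow> clan_symbol list set" where
  "clan_neg \<gamma> = map neg_symbol ` \<gamma>"

definition skew_symmetric_clans :: "nat \<Rightarrow> clan_symbol list set set" where
  "skew_symmetric_clans n = {\<gamma> \<in> clans n. \<gamma> = clan_neg (clan_rev \<gamma>)}"

text \<open>A signed permutation is its word, a list of nonzero integers; a barred letter is a negative
  entry. Letters and positions are numbered from 1, list indices from 0, so the letter at
  position \<open>i\<close> is \<open>w ! (i - 1)\<close>.\<close>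

definition signed_permutations :: "nat \<Rightarrow> int list set" where
  "signed_permutations m =
     {w. length w = m \<and> distinct (map abs w) \<and> set (map abs w) = {1..int m}}"

definition letter :: "int list \<Rightarrow> nat \<Rightarrow> int" where
  "letter w i = w ! (i - 1)"

definition barred :: "int list \<Rightarrow> nat \<Rightarrow> bool" where
  "barred w i \<longleftrightarrow> letter w i < 0"

definition abs_perm :: "int list \<Rightarrow> nat \<Rightarrow> nat" where
  "abs_perm w i = nat \<bar>letter w i\<bar>"

definition signed_involutions :: "nat \<Rightarrow> int list set" where
  "signed_involutions m = {w \<in> signed_permutations m.
     \<forall>i\<in>{1..m}. abs_perm w (abs_perm w i) = i \<and> (barred w i \<longleftrightarrow> barred w (abs_perm w i))}"

definition Comp :: "int list \<Rightarrow> int list" where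
  "Comp w = map (\<lambda>a. sgn a * (int (length w) + 1 - \<bar>a\<bar>)) w"

definition avoids_bar2_bar1 :: "int list \<Rightarrow> bool" where
  "avoids_bar2_bar1 w \<longleftrightarrow>
     \<not> (\<exists>i\<in>{1..length w}. \<exists>j\<in>{1..length w}.
          i < j \<and> barred w i \<and> barred w j \<and> abs_perm w i > abs_perm w j)"

definition restricted_involutions :: "nat \<Rightarrow> int list set" where
  "restricted_involutions m = {w \<in> signed_involutions m. w = rev (Comp w) \<and> avoids_bar2_bar1 w}"

end

theory Submission
  imports Defs "HOL-Library.FuncSet"
begin

text \<open>The two letters of a barred 2-cycle form the forbidden pattern, so avoidance means that only
  fixed points carry bars. Clans and pattern-avoiding signed involutions are therefore both
  involutions with two kinds of fixed points. Skew-symmetry flips the signs of mirror-image fixed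
  points, whereas invariance under \<open>Rev \<circ> Comp\<close> preserves bars; the two match if a fixed
  point is barred when it is a \<open>-\<close> in the left half or a \<open>+\<close> in the right half. The
  length is even, so no position is its own mirror image, and skew-symmetry forces equally many
  \<open>+\<close> and \<open>-\<close>.\<close>

section \<open>Signed words as involutions on positions with marked fixed points\<close>

text \<open>Positions are list indices, so letters are shifted down by one. The truncated
  subtraction sends a zero entry to 0 as well, so nonzero entries have to be required
  separately.\<close>

definition partner :: "int list \<Rightarrow> nat \<Rightarrow> nat" where
  "partner w i = nat \<bar>w ! i\<bar> - 1"

text \<open>For the converse: if every barred position is fixed, the barred letters increase from
  left to right; and a self-inverse map on positions is a permutation, which recovers
  \<open>signed_permutations\<close>.\<close>

lemma avoiding_signed_involution_iff:
  "w \<in> signed_involutions m \<and> avoids_bar2_bar1 w \<longleftrightarrow>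
     length w = m \<and> (\<forall>i<m. w ! i \<noteq> 0 \<and> partner w i < m \<and> partner w (partner w i) = i
       \<and> (w ! i < 0 \<longrightarrow> partner w i = i))" (is "?L \<longleftrightarrow> ?R")
proof
  assume L: ?L
  then have len: "length w = m" and set: "set (map abs w) = {1..int m}"
    and inv: "\<And>i. i \<in> {1..m} \<Longrightarrow> abs_perm w (abs_perm w i) = i"
    and bar: "\<And>i. i \<in> {1..m} \<Longrightarrow> barred w i \<longleftrightarrow> barred w (abs_perm w i)"
    by (auto simp: signed_involutions_def signed_permutations_def)
  have av: "abs_perm w i \<le> abs_perm w j"
    if "i \<in> {1..m}" "j \<in> {1..m}" "i < j" "barred w i" "barred w j" for i j
    using L len that unfolding avoids_bar2_bar1_def by (metis not_less)
  have rng: "\<bar>w ! i\<bar> \<in> {1..int m}" if "i < m" for i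
    using that len set by (metis imageI list.set_map nth_mem)
  have perm: "abs_perm w (Suc i) = Suc (partner w i)" if "i < m" for i
    using rng[OF that] by (auto simp: abs_perm_def letter_def partner_def)
  have "w ! i \<noteq> 0 \<and> partner w i < m \<and> partner w (partner w i) = i
      \<and> (w ! i < 0 \<longrightarrow> partner w i = i)" if i: "i < m" for i
  proof -
    have nz: "w ! i \<noteq> 0" and lt: "partner w i < m"
      using rng[OF i] by (auto simp: partner_def)
    have pp: "partner w (partner w i) = i"
      using inv[of "Suc i"] i perm lt by simp
    have fixed: "partner w i = i" if neg: "w ! i < 0"
    proof -
      have b: "barred w (Suc i)"
        using neg by (simp add: barred_def letter_def)
      then have b': "barred w (Suc (partner w i))"
        using bar[of "Suc i"] i perm by simp
      \<comment> \<open>If \<open>i\<close> and its partner differed, both would be barred and,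
        taken in increasing order, would form the forbidden pattern; hence \<open>av\<close> in both
        orders.\<close>
      show ?thesis
        using av[of "Suc i" "Suc (partner w i)"] av[of "Suc (partner w i)" "Suc i"]
          b b' i lt perm pp by (cases i "partner w i" rule: linorder_cases) auto
    qed
    show ?thesis using nz lt pp fixed by blast
  qed
  with len show ?R by blast
next
  assume R: ?R
  then have len: "length w = m" by blast
  have perm: "abs_perm w (Suc i) = Suc (partner w i)" if "i < m" for i
    using R that by (auto simp: abs_perm_def letter_def partner_def)
  have abs_w: "\<bar>w ! i\<bar> = int (Suc (partner w i))" if "i < m" for i
    using R that by (auto simp: partner_def)
  have bij: "bij_betw (partner w) {..<m} {..<m}"
    using R by (intro bij_betwI[where g = "partner w"]) auto
  have map_abs: "map abs w = map (\<lambda>i. int (Suc (partner w i))) [0..<m]"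
    using len abs_w by (intro nth_equalityI) auto
  have "inj_on (\<lambda>i. int (Suc (partner w i))) {..<m}"
    using bij by (auto simp: bij_betw_def inj_on_def)
  then have "distinct (map abs w)"
    unfolding map_abs by (simp add: distinct_map atLeast_upt)
  moreover have "set (map abs w) = {1..int m}"
  proof -
    have "set (map abs w) = (\<lambda>k. int (Suc k)) ` partner w ` {..<m}"
      unfolding map_abs by (simp add: image_image atLeast_upt)
    also have "\<dots> = (\<lambda>k. int (Suc k)) ` {..<m}"
      using bij by (simp add: bij_betw_def)
    also have "\<dots> = {1..int m}"
    proof (intro set_eqI iffI)
      fix x assume "x \<in> {1..int m}"
      then have "x = int (Suc (nat x - 1))" "nat x - 1 < m" by auto
      then show "x \<in> (\<lambda>k. int (Suc k)) ` {..<m}" by blast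
    qed auto
    finally show ?thesis .
  qed
  moreover have "abs_perm w (abs_perm w i) = i \<and> (barred w i \<longleftrightarrow> barred w (abs_perm w i))"
    if "i \<in> {1..m}" for i
  proof -
    define k where "k = i - 1"
    have k: "i = Suc k" "k < m" using \<open>i \<in> {1..m}\<close> by (auto simp: k_def)
    \<comment> \<open>A bar at either end of a cycle makes that end a fixed point, so the two ends
      coincide.\<close>
    have "w ! partner w k < 0 \<longleftrightarrow> w ! k < 0"
      using R k by metis
    then show ?thesis
      using R k perm by (auto simp: barred_def letter_def)
  qed
  ultimately have "w \<in> signed_involutions m"
    using len by (simp add: signed_involutions_def signed_permutations_def)
  moreover have "abs_perm w i = i" if "i \<in> {1..m}" "barred w i" for i
    using that R perm by (cases i) (auto simp: barred_def letter_def)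
  then have "avoids_bar2_bar1 w"
    using len unfolding avoids_bar2_bar1_def by fastforce
  ultimately show ?L by blast
qed

section \<open>Clan strings as involutions on positions\<close>

lemma count_list_eq_card: "count_list c s = card (symbol_positions s c)"
  by (simp add: count_list_eq_length_filter length_filter_conv_card symbol_positions_def
      eq_commute[of s])

lemma neg_symbol_neg_symbol [simp]: "neg_symbol (neg_symbol s) = s"
  by (cases s) auto

lemma neg_symbol_eq_iff: "neg_symbol s = t \<longleftrightarrow> s = neg_symbol t"
  by auto

text \<open>The involution underlying a clan, with the signs as fixed points. At a number, the
  description is meaningful where \<open>ex1_mate\<close> applies.\<close>

definition mate :: "clan_symbol list \<Rightarrow> nat \<Rightarrow> nat" where
  "mate c i = (if c ! i \<in> {Plus, Minus} then i else THE j. j < length c \<and> j \<noteq> i \<and> c ! j = c ! i)"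

lemma ex1_mate:
  assumes "c \<in> clan_strings n" "i < 2 * n" "c ! i \<notin> {Plus, Minus}"
  shows "\<exists>!j. j < length c \<and> j \<noteq> i \<and> c ! j = c ! i"
proof -
  obtain a where a: "c ! i = Num a" using assms(3) by (cases "c ! i") auto
  have len: "length c = 2 * n" using assms(1) by (simp add: clan_strings_def)
  then have "Num a \<in> set c" using a assms(2) by (metis nth_mem)
  then have "card (symbol_positions (Num a) c) = 2"
    using assms(1) by (simp add: clan_strings_def flip: count_list_eq_card)
  then obtain x y where xy: "x \<noteq> y" "symbol_positions (Num a) c = {x, y}"
    by (auto simp: card_2_iff)
  have pos: "k < length c \<and> c ! k = Num a \<longleftrightarrow> k = x \<or> k = y" for k
    using xy(2) unfolding symbol_positions_def by blast
  have "i = x \<or> i = y" using pos[of i] a assms(2) len by simp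
  then show ?thesis using pos xy(1) a by metis
qed

lemma mate_eqI:
  assumes "c \<in> clan_strings n" "i < 2 * n" "j < 2 * n" "j \<noteq> i" "c ! j = c ! i"
    "c ! i \<notin> {Plus, Minus}"
  shows "mate c i = j"
proof -
  have "j < length c" using assms by (simp add: clan_strings_def)
  then have "(THE j. j < length c \<and> j \<noteq> i \<and> c ! j = c ! i) = j"
    using assms by (intro the1_equality ex1_mate) auto
  then show ?thesis using assms(6) by (simp add: mate_def)
qed

lemma mate_sign: "c ! i \<in> {Plus, Minus} \<Longrightarrow> mate c i = i"
  by (simp add: mate_def)

lemma mate_num:
  assumes "c \<in> clan_strings n" "i < 2 * n" "c ! i \<notin> {Plus, Minus}"
  shows "mate c i < 2 * n" "mate c i \<noteq> i" "c ! mate c i = c ! i"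
  using theI'[OF ex1_mate[OF assms]] assms
  by (auto simp: mate_def clan_strings_def)

lemma mate_less:
  assumes "c \<in> clan_strings n" "i < 2 * n"
  shows "mate c i < 2 * n"
  using mate_num(1)[OF assms] mate_sign[of c i] assms(2) by metis

lemma mate_eq_self_iff:
  assumes "c \<in> clan_strings n" "i < 2 * n"
  shows "mate c i = i \<longleftrightarrow> c ! i \<in> {Plus, Minus}"
  using mate_num(2)[OF assms] mate_sign by blast

lemma mate_mate:
  assumes "c \<in> clan_strings n" "i < 2 * n"
  shows "mate c (mate c i) = i"
proof (cases "c ! i \<in> {Plus, Minus}")
  case True
  then show ?thesis by (simp add: mate_sign)
next
  case False
  note m = mate_num[OF assms False]
  show ?thesis
    by (rule mate_eqI[OF assms(1) m(1) assms(2) m(2)[symmetric]]) (use m False in auto)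
qed

lemma mem_matching_pairs_iff:
  assumes "c \<in> clan_strings n"
  shows "(i, j) \<in> matching_pairs c \<longleftrightarrow> i < j \<and> j < 2 * n \<and> mate c i = j"
proof
  have len: "length c = 2 * n" using assms by (simp add: clan_strings_def)
  {
    assume "(i, j) \<in> matching_pairs c"
    then obtain a where "i < j" "j < 2 * n" "c ! i = Num a" "c ! j = Num a"
      using len by (auto simp: matching_pairs_def)
    then show "i < j \<and> j < 2 * n \<and> mate c i = j"
      using mate_eqI[OF assms, of i j] by simp
  next
    assume r: "i < j \<and> j < 2 * n \<and> mate c i = j"
    then have ns: "c ! i \<notin> {Plus, Minus}"
      using mate_sign[of c i] by auto
    then obtain a where "c ! i = Num a" by (cases "c ! i") auto
    then show "(i, j) \<in> matching_pairs c"
      using r ns len mate_num(3)[OF assms, of i] by (auto simp: matching_pairs_def)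
  }
qed

text \<open>Matching pairs record each 2-cycle of \<open>mate\<close> once, from its smaller end. As
  \<open>mate\<close> is an involution, they determine it everywhere, and equality of clans becomes
  a condition position by position.\<close>

lemma clan_rel_iff:
  "(c, d) \<in> clan_rel n \<longleftrightarrow> c \<in> clan_strings n \<and> d \<in> clan_strings n
     \<and> (\<forall>i<2 * n. (c ! i = Plus \<longleftrightarrow> d ! i = Plus) \<and> (c ! i = Minus \<longleftrightarrow> d ! i = Minus)
          \<and> mate c i = mate d i)"
proof (cases "c \<in> clan_strings n \<and> d \<in> clan_strings n")
  case True
  then have c: "c \<in> clan_strings n" and d: "d \<in> clan_strings n" by auto
  then have len: "length c = 2 * n" "length d = 2 * n" by (auto simp: clan_strings_def)
  have sym: "symbol_positions s c = symbol_positions s d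
      \<longleftrightarrow> (\<forall>i<2 * n. c ! i = s \<longleftrightarrow> d ! i = s)" for s
    using len by (auto simp: symbol_positions_def set_eq_iff)
  have "matching_pairs c = matching_pairs d \<longleftrightarrow> (\<forall>i<2 * n. mate c i = mate d i)" (is "?M \<longleftrightarrow> ?E")
  proof
    assume ?E
    then have "(i, j) \<in> matching_pairs c \<longleftrightarrow> (i, j) \<in> matching_pairs d" for i j
      unfolding mem_matching_pairs_iff[OF c] mem_matching_pairs_iff[OF d] by auto
    then show ?M by auto
  next
    assume M: ?M
    have eq: "(i < j \<and> j < 2 * n \<and> mate c i = j) \<longleftrightarrow> (i < j \<and> j < 2 * n \<and> mate d i = j)" for i j
      using M mem_matching_pairs_iff[OF c] mem_matching_pairs_iff[OF d] by metis
    have "mate c i = mate d i" if i: "i < 2 * n" for i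
    proof (cases "mate c i" i rule: linorder_cases)
      \<comment> \<open>The pair is listed under its smaller end \<open>mate c i\<close>, so the two
        mates are compared there and the result is carried back by the involution
        \<open>mate d\<close>.\<close>
      case less
      then have "mate d (mate c i) = i"
        using eq[of "mate c i" i] i mate_mate[OF c i] by simp
      then show ?thesis
        using mate_mate[OF d mate_less[OF c i]] by simp
    next
      case equal
      then have "\<not> mate d i < i"
        using eq[of "mate d i" i] i mate_mate[OF d i] mate_mate[OF c mate_less[OF d i]] by auto
      then show ?thesis
        using eq[of i "mate d i"] mate_less[OF d i] equal
        by (metis linorder_neqE_nat)
    next
      case greater
      then show ?thesis
        using eq[of i "mate c i"] mate_less[OF c i] by simp
    qed
    then show ?E by blast
  qed
  then show ?thesis
    using True by (auto simp: clan_rel_def sym)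
qed (auto simp: clan_rel_def)

section \<open>From clan strings to signed words\<close>

text \<open>Numbers are never barred. With 0-based positions and length \<open>2 * n\<close>, the
  test selects the first \<open>n\<close> positions; swapping the roles of the signs at the midpoint
  compensates for the negation in skew-symmetry.\<close>

definition bar_at :: "clan_symbol list \<Rightarrow> nat \<Rightarrow> bool" where
  "bar_at c i \<longleftrightarrow> (if 2 * i < length c then c ! i = Minus else c ! i = Plus)"

definition clan_word :: "clan_symbol list \<Rightarrow> int list" where
  "clan_word c = map (\<lambda>i. (if bar_at c i then -1 else 1) * int (Suc (mate c i))) [0..<length c]"

lemma length_clan_word [simp]: "length (clan_word c) = length c"
  by (simp add: clan_word_def)

lemma nth_clan_word:
  "i < length c \<Longrightarrow> clan_word c ! i = (if bar_at c i then -1 else 1) * int (Suc (mate c i))"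
  by (simp add: clan_word_def)

lemma clan_word_signed_involution:
  assumes c: "c \<in> clan_strings n"
  shows "clan_word c \<in> signed_involutions (2 * n)" "avoids_bar2_bar1 (clan_word c)"
proof -
  have len: "length c = 2 * n" using c by (simp add: clan_strings_def)
  have p: "partner (clan_word c) i = mate c i" if "i < 2 * n" for i
    using that len by (auto simp: partner_def nth_clan_word)
  have b: "mate c i = i" if "clan_word c ! i < 0" "i < 2 * n" for i
    using that len by (auto simp: nth_clan_word bar_at_def intro!: mate_sign split: if_splits)
  have "clan_word c \<in> signed_involutions (2 * n) \<and> avoids_bar2_bar1 (clan_word c)"
    unfolding avoiding_signed_involution_iff
    using len p b mate_less[OF c] mate_mate[OF c] by (simp add: nth_clan_word)
  then show "clan_word c \<in> signed_involutions (2 * n)" "avoids_bar2_bar1 (clan_word c)"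
    by auto
qed

text \<open>The word is a complete invariant of the clan: absolute values give \<open>mate\<close>,
  and at a fixed point the bar together with the half gives the sign.\<close>

lemma clan_word_eq_iff:
  assumes c: "c \<in> clan_strings n" and d: "d \<in> clan_strings n"
  shows "clan_word c = clan_word d \<longleftrightarrow> (c, d) \<in> clan_rel n"
proof -
  have len: "length c = 2 * n" "length d = 2 * n"
    using c d by (auto simp: clan_strings_def)
  \<comment> \<open>\<open>Suc\<close> keeps the magnitude positive, so bar and mate can be read off
    separately.\<close>
  have eq: "(if b then - 1 else 1) * int (Suc x) = (if b' then - 1 else 1) * int (Suc y)
      \<longleftrightarrow> (b \<longleftrightarrow> b') \<and> x = y" for b b' x y
    by auto
  have "clan_word c = clan_word d
      \<longleftrightarrow> (\<forall>i<2 * n. (bar_at c i \<longleftrightarrow> bar_at d i) \<and> mate c i = mate d i)"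
    using len by (simp add: list_eq_iff_nth_eq nth_clan_word eq del: of_nat_Suc)
  also have "\<dots> \<longleftrightarrow> (c, d) \<in> clan_rel n"
  proof -
    have "(bar_at c i \<longleftrightarrow> bar_at d i) \<longleftrightarrow>
        (c ! i = Plus \<longleftrightarrow> d ! i = Plus) \<and> (c ! i = Minus \<longleftrightarrow> d ! i = Minus)"
      if "i < 2 * n" "mate c i = mate d i" for i
    proof -
      have "c ! i \<in> {Plus, Minus} \<longleftrightarrow> d ! i \<in> {Plus, Minus}"
        using that mate_eq_self_iff[OF c] mate_eq_self_iff[OF d] by metis
      then show ?thesis
        using len by (cases "c ! i"; cases "d ! i") (auto simp: bar_at_def)
    qed
    then show ?thesis using c d by (auto simp: clan_rel_iff)
  qed
  finally show ?thesis .
qed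

section \<open>Negated reversal of strings against reverse complement of words\<close>

definition neg_rev :: "clan_symbol list \<Rightarrow> clan_symbol list" where
  "neg_rev c = map neg_symbol (rev c)"

lemma length_neg_rev [simp]: "length (neg_rev c) = length c"
  by (simp add: neg_rev_def)

lemma nth_neg_rev: "i < length c \<Longrightarrow> neg_rev c ! i = neg_symbol (c ! (length c - Suc i))"
  by (simp add: neg_rev_def rev_nth)

lemma neg_rev_neg_rev [simp]: "neg_rev (neg_rev c) = c"
  by (simp add: neg_rev_def rev_map o_def)

lemma clan_neg_clan_rev: "clan_neg (clan_rev \<gamma>) = neg_rev ` \<gamma>"
  by (auto simp: clan_neg_def clan_rev_def neg_rev_def image_image)

lemma count_list_neg_rev: "count_list (neg_rev c) s = count_list c (neg_symbol s)"
  by (induction c) (auto simp: neg_rev_def neg_symbol_eq_iff)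

lemma neg_rev_clan_strings:
  assumes "c \<in> clan_strings n"
  shows "neg_rev c \<in> clan_strings n"
proof -
  have "Num a \<in> set c" if "Num a \<in> set (neg_rev c)" for a
    using that by (auto simp: neg_rev_def elim!: neg_symbol.elims[OF sym])
  then show ?thesis
    using assms by (auto simp: clan_strings_def count_list_neg_rev)
qed

text \<open>Negation fixes numbers and sends signs to signs, so only the reversal matters: it
  conjugates \<open>mate\<close> by the reflection of positions.\<close>

lemma mate_neg_rev:
  assumes c: "c \<in> clan_strings n" and i: "i < 2 * n"
  shows "mate (neg_rev c) i = 2 * n - Suc (mate c (2 * n - Suc i))"
proof -
  have len: "length c = 2 * n" using c by (simp add: clan_strings_def)
  let ?i = "2 * n - Suc i"
  have i': "?i < 2 * n" using i by simp
  show ?thesis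
  proof (cases "c ! ?i \<in> {Plus, Minus}")
    case True
    then show ?thesis
      using i len by (auto simp: mate_sign nth_neg_rev)
  next
    case False
    note m = mate_num[OF c i' False]
    have ns: "neg_symbol (c ! ?i) \<notin> {Plus, Minus}"
      using False by (cases "c ! ?i") auto
    have "2 * n - Suc (mate c ?i) < 2 * n" "2 * n - Suc (mate c ?i) \<noteq> i"
      using m(1,2) i by auto
    then show ?thesis
      using i len m ns by (intro mate_eqI[OF neg_rev_clan_strings[OF c]]) (auto simp: nth_neg_rev)
  qed
qed

text \<open>Conjugation by the reflection amounts to reversing the word and complementing its
  letters. Bars travel along unchanged, since the flip of a sign and its move to the other half
  cancel in \<open>bar_at\<close>.\<close>

lemma clan_word_neg_rev:
  assumes c: "c \<in> clan_strings n"
  shows "clan_word (neg_rev c) = rev (Comp (clan_word c))"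
proof (rule nth_equalityI)
  have len: "length c = 2 * n" using c by (simp add: clan_strings_def)
  fix i assume "i < length (clan_word (neg_rev c))"
  then have i: "i < 2 * n" using len by simp
  let ?i = "2 * n - Suc i"
  have i': "?i < 2 * n" using i by simp
  \<comment> \<open>The even length leaves no middle position, so exactly one of a position and its
    mirror image lies in the left half.\<close>
  have half: "2 * i < 2 * n \<longleftrightarrow> \<not> 2 * ?i < 2 * n" using i by auto
  have bar: "bar_at (neg_rev c) i = bar_at c ?i"
    using i len half by (simp add: bar_at_def nth_neg_rev neg_symbol_eq_iff)
  have m: "mate c ?i < 2 * n" using mate_less[OF c i'] .
  then show "clan_word (neg_rev c) ! i = rev (Comp (clan_word c)) ! i"
    using i i' len
    by (simp add: nth_clan_word Comp_def rev_nth bar mate_neg_rev[OF c] of_nat_diff)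
qed (simp add: Comp_def)

section \<open>From restricted involutions back to clan strings\<close>

text \<open>The smaller position of a 2-cycle serves as its label, so distinct cycles get distinct
  numbers; the sign rule inverts \<open>bar_at\<close>.\<close>

definition word_clan :: "int list \<Rightarrow> clan_symbol list" where
  "word_clan w = map (\<lambda>i. if partner w i \<noteq> i then Num (min i (partner w i))
     else if (w ! i < 0) = (2 * i < length w) then Minus else Plus) [0..<length w]"

lemma length_word_clan [simp]: "length (word_clan w) = length w"
  by (simp add: word_clan_def)

lemma nth_word_clan:
  "i < length w \<Longrightarrow> word_clan w ! i = (if partner w i \<noteq> i then Num (min i (partner w i))
     else if (w ! i < 0) = (2 * i < length w) then Minus else Plus)"
  by (simp add: word_clan_def)

text \<open>The witness is \<open>word_clan w\<close>. Invariance under reverse complement balances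
  its signs: mirror-image fixed points share their bar status but lie in different halves, so they
  carry opposite signs.\<close>

lemma restricted_involution_ex_clan:
  assumes w: "w \<in> restricted_involutions (2 * n)"
  obtains c where "c \<in> clan_strings n" "clan_word c = w"
proof
  let ?c = "word_clan w"
  from w have av: "w \<in> signed_involutions (2 * n) \<and> avoids_bar2_bar1 w"
    and sym: "w = rev (Comp w)"
    by (auto simp: restricted_involutions_def)
  from av[unfolded avoiding_signed_involution_iff]
  have len: "length w = 2 * n" and nz: "\<And>i. i < 2 * n \<Longrightarrow> w ! i \<noteq> 0"
    and lt: "\<And>i. i < 2 * n \<Longrightarrow> partner w i < 2 * n"
    and pp: "\<And>i. i < 2 * n \<Longrightarrow> partner w (partner w i) = i"
    and neg: "\<And>i. i < 2 * n \<Longrightarrow> w ! i < 0 \<Longrightarrow> partner w i = i"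
    by auto
  have abs_w: "\<bar>w ! i\<bar> = int (Suc (partner w i))" if "i < 2 * n" for i
    using nz[OF that] by (auto simp: partner_def)
  have symw: "w ! i = sgn (w ! (2 * n - Suc i)) * (2 * int n + 1 - \<bar>w ! (2 * n - Suc i)\<bar>)"
    if "i < 2 * n" for i
    using arg_cong[OF sym, of "\<lambda>w. w ! i"] that len by (simp add: Comp_def rev_nth)
  have mirror: "(w ! (2 * n - Suc i) < 0 \<longleftrightarrow> w ! i < 0)
      \<and> partner w (2 * n - Suc i) = 2 * n - Suc (partner w i)" if i: "i < 2 * n" for i
  proof -
    let ?i = "2 * n - Suc i"
    have i': "?i < 2 * n" "2 * n - Suc ?i = i" using i by auto
    have s: "w ! ?i = sgn (w ! i) * (2 * int n - int (partner w i))"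
      using symw[OF i'(1)] abs_w[OF i] i'(2) by simp
    \<comment> \<open>The complemented magnitude is positive, so \<open>sgn\<close> alone decides
      the bar and the truncated subtraction in \<open>partner\<close> loses nothing.\<close>
    have "0 < 2 * int n - int (partner w i)" using lt[OF i] by simp
    then show ?thesis
      using s nz[OF i] lt[OF i] by (cases "w ! i" "0 :: int" rule: linorder_cases)
        (auto simp: partner_def)
  qed
  have fixed_sym: "?c ! (2 * n - Suc i) = Minus \<longleftrightarrow> ?c ! i = Plus" if i: "i < 2 * n" for i
  proof -
    have "2 * (2 * n - Suc i) < 2 * n \<longleftrightarrow> \<not> 2 * i < 2 * n" using i by auto
    moreover have "2 * n - Suc (partner w i) = 2 * n - Suc i \<longleftrightarrow> partner w i = i"
      using i lt[OF i] by auto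
    ultimately show ?thesis
      using i len mirror[OF i] by (auto simp: nth_word_clan)
  qed
  have "bij_betw (\<lambda>i. 2 * n - Suc i) (symbol_positions Plus ?c) (symbol_positions Minus ?c)"
  proof (intro bij_betwI[where g = "\<lambda>i. 2 * n - Suc i"] funcsetI)
    fix i assume "i \<in> symbol_positions Plus ?c"
    then show "2 * n - Suc i \<in> symbol_positions Minus ?c"
      using fixed_sym[of i] len by (auto simp: symbol_positions_def)
  next
    fix i assume "i \<in> symbol_positions Minus ?c"
    then show "2 * n - Suc i \<in> symbol_positions Plus ?c"
      using fixed_sym[of "2 * n - Suc i"] len by (auto simp: symbol_positions_def)
  qed (use len in \<open>auto simp: symbol_positions_def\<close>)
  then have balanced: "count_list ?c Plus = count_list ?c Minus"
    unfolding count_list_eq_card by (rule bij_betw_same_card)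
  \<comment> \<open>Labels agree only within one cycle; this yields both the count of two for each
    number and the mates.\<close>
  have same: "?c ! j = ?c ! i \<longleftrightarrow> j = i \<or> j = partner w i"
    if "i < 2 * n" "j < 2 * n" "partner w i \<noteq> i" for i j
  proof (cases "partner w j = j")
    case True
    then show ?thesis
      using that len pp[of i] by (auto simp: nth_word_clan)
  next
    case False
    have ij: "?c ! j = ?c ! i \<longleftrightarrow> min j (partner w j) = min i (partner w i)"
      using that len False by (simp add: nth_word_clan)
    show ?thesis
    proof
      assume "?c ! j = ?c ! i"
      \<comment> \<open>Equal minima leave four possible coincidences, which the involution reduces
        to two.\<close>
      then have "j = i \<or> j = partner w i \<or> partner w j = i \<or> partner w j = partner w i"
        unfolding ij by (metis min_def)
      then show "j = i \<or> j = partner w i"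
        using pp[OF that(1)] pp[OF that(2)] by metis
    next
      assume "j = i \<or> j = partner w i"
      then show "?c ! j = ?c ! i"
        unfolding ij using pp[OF that(1)] by (metis min.commute)
    qed
  qed
  have "count_list ?c (Num a) = 2" if "Num a \<in> set ?c" for a
  proof -
    obtain i where i: "i < 2 * n" "?c ! i = Num a"
      using \<open>Num a \<in> set ?c\<close> len by (auto simp: in_set_conv_nth)
    then have ne: "partner w i \<noteq> i" using len by (auto simp: nth_word_clan split: if_splits)
    have "symbol_positions (Num a) ?c = {i, partner w i}"
      using same[OF i(1) _ ne] i lt[OF i(1)] len by (auto simp: symbol_positions_def)
    then show ?thesis using ne by (simp add: count_list_eq_card)
  qed
  with balanced len show c: "?c \<in> clan_strings n"
    by (auto simp: clan_strings_def)
  have mate: "mate ?c i = partner w i" if i: "i < 2 * n" for i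
  proof (cases "partner w i = i")
    case True
    then show ?thesis using i len by (simp add: mate_sign nth_word_clan)
  next
    case False
    then show ?thesis
      using i len lt[OF i] same[OF i lt[OF i]]
      by (intro mate_eqI[OF c]) (auto simp: nth_word_clan)
  qed
  show "clan_word ?c = w"
  proof (rule nth_equalityI)
    fix i assume "i < length (clan_word ?c)"
    then have i: "i < 2 * n" using len by simp
    \<comment> \<open>Off the fixed points both sides are false: a number is never barred, and
      \<open>neg\<close> excludes a negative entry.\<close>
    have "bar_at ?c i \<longleftrightarrow> w ! i < 0"
      using i len neg[OF i] by (auto simp: bar_at_def nth_word_clan)
    then show "clan_word ?c ! i = w ! i"
      using i len mate[OF i] abs_w[OF i] by (auto simp: nth_clan_word)
  qed simp
qed

section \<open>Passage to equivalence classes and the bijection\<close>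

text \<open>The operations on clans are images of sets, so the image has to be a whole class.
  \<open>neg_rev\<close> respects \<open>clan_rel\<close> because equal words have equal reverse
  complements, and being its own inverse it reaches every member.\<close>

lemma neg_rev_class:
  assumes c: "c \<in> clan_strings n"
  shows "neg_rev ` (clan_rel n `` {c}) = clan_rel n `` {neg_rev c}"
proof -
  have rel: "(neg_rev a, neg_rev b) \<in> clan_rel n" if "(a, b) \<in> clan_rel n" for a b
    using that clan_word_neg_rev clan_word_eq_iff neg_rev_clan_strings
    by (metis clan_rel_iff)
  show ?thesis
  proof (intro set_eqI iffI)
    fix d assume "d \<in> clan_rel n `` {neg_rev c}"
    then have "neg_rev d \<in> clan_rel n `` {c}" using rel[of "neg_rev c" d] by simp
    then show "d \<in> neg_rev ` (clan_rel n `` {c})"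
      by (metis imageI neg_rev_neg_rev)
  qed (use rel in auto)
qed

text \<open>Words of clan strings are already pattern-avoiding signed involutions, so only the two
  symmetry equations remain to be compared, and \<open>clan_word_neg_rev\<close> matches
  them.\<close>

lemma clan_class_skew_iff:
  assumes c: "c \<in> clan_strings n"
  shows "clan_rel n `` {c} \<in> skew_symmetric_clans n
    \<longleftrightarrow> clan_word c \<in> restricted_involutions (2 * n)"
proof -
  have "clan_rel n `` {c} \<in> skew_symmetric_clans n
      \<longleftrightarrow> clan_rel n `` {c} = clan_rel n `` {neg_rev c}"
    using c by (simp add: skew_symmetric_clans_def clans_def quotientI clan_neg_clan_rev
        neg_rev_class)
  also have "\<dots> \<longleftrightarrow> (c, neg_rev c) \<in> clan_rel n"
    using eq_equiv_class_iff[OF equiv_clan_rel c neg_rev_clan_strings[OF c]] .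
  also have "\<dots> \<longleftrightarrow> clan_word c = rev (Comp (clan_word c))"
    using clan_word_eq_iff[OF c neg_rev_clan_strings[OF c]] clan_word_neg_rev[OF c] by simp
  also have "\<dots> \<longleftrightarrow> clan_word c \<in> restricted_involutions (2 * n)"
    using clan_word_signed_involution[OF c] by (simp add: restricted_involutions_def)
  finally show ?thesis .
qed

theorem theorem3p14:
  fixes n :: nat
  assumes "n \<ge> 1"
  shows "\<exists>f. bij_betw f (restricted_involutions (2 * n)) (skew_symmetric_clans n)"
proof -
  \<comment> \<open>Strings differing only in their numbers share a word, so a representative is
    chosen; its class does not depend on the choice.\<close>
  define g where "g w = (SOME c. c \<in> clan_strings n \<and> clan_word c = w)" for w
  have g: "g w \<in> clan_strings n" "clan_word (g w) = w" if "w \<in> restricted_involutions (2 * n)" for w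
    using someI_ex[of "\<lambda>c. c \<in> clan_strings n \<and> clan_word c = w"]
      restricted_involution_ex_clan[OF that] unfolding g_def by blast+
  have "bij_betw (\<lambda>w. clan_rel n `` {g w}) (restricted_involutions (2 * n)) (skew_symmetric_clans n)"
  proof (rule bij_betw_imageI)
    show "inj_on (\<lambda>w. clan_rel n `` {g w}) (restricted_involutions (2 * n))"
      using g eq_equiv_class_iff[OF equiv_clan_rel] clan_word_eq_iff
      by (intro inj_onI) metis
    show "(\<lambda>w. clan_rel n `` {g w}) ` restricted_involutions (2 * n) = skew_symmetric_clans n"
    proof (intro set_eqI iffI)
      fix \<gamma> assume "\<gamma> \<in> (\<lambda>w. clan_rel n `` {g w}) ` restricted_involutions (2 * n)"
      then show "\<gamma> \<in> skew_symmetric_clans n" using g clan_class_skew_iff by auto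
    next
      fix \<gamma> assume skew: "\<gamma> \<in> skew_symmetric_clans n"
      then obtain c where c: "c \<in> clan_strings n" "\<gamma> = clan_rel n `` {c}"
        by (auto simp: skew_symmetric_clans_def clans_def elim: quotientE)
      then have r: "clan_word c \<in> restricted_involutions (2 * n)"
        using skew clan_class_skew_iff by blast
      \<comment> \<open>The chosen representative may differ from \<open>c\<close> as a string, but
        it has the same word and hence the same class.\<close>
      then have "\<gamma> = clan_rel n `` {g (clan_word c)}"
        using c g[OF r] clan_word_eq_iff[of c n "g (clan_word c)"]
          eq_equiv_class_iff[OF equiv_clan_rel] by metis
      with r show "\<gamma> \<in> (\<lambda>w. clan_rel n `` {g w}) ` restricted_involutions (2 * n)" by blast
    qed
  qed
  then show ?thesis by blast
qed

end
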